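(* Each of the operations $T_{\mathrm G}(x,y)=\min\{x,y\}$, $T_{\mathrm L}(x,y)=\max\{0,x+y-1\}$ and $T_{\mathrm P}(x,y)=xy$ on $[0,1]^2$ admits a simultaneous realization for every $(x,y)\in[0,1]^2$ by a pair of event chains; moreover, for $T_{\mathrm G}$ the chains can be taken comonotone, for $T_{\mathrm L}$ countermonotone, and for $T_{\mathrm P}$ independent.
   Context: A simultaneous realization of $T:[0,1]^2\to[0,1]$ by event chains consists of a nonatomic probability space $(\Omega,\mu)$ and two families of events $(A_x)_{x\in[0,1]}$, $(B_y)_{y\in[0,1]}$, each increasing (by inclusion) in its index, with $\mu(A_x)=x$, $\mu(B_y)=y$, and $\mu(A_x\cap B_y)=T(x,y)$ for all $(x,y)\in[0,1]^2$. The two chains are comonotone if for all $x,y$ the events $A_x$ and $B_y$ are comparable under inclusion; countermonotone if for all $x,y$ the events $A_x$ and $B_y^c$ are comparable under inclusion; independent if $\mu(A_x\cap B_y)=\mu(A_x)\mu(B_y)$ for all $x,y$. *)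

theory Defs
  imports "HOL-Probability.Probability"
begin

definition T_G :: "real \<Rightarrow> real \<Rightarrow> real" where
  "T_G x y = min x y"

definition T_L :: "real \<Rightarrow> real \<Rightarrow> real" where
  "T_L x y = max 0 (x + y - 1)"

definition T_P :: "real \<Rightarrow> real \<Rightarrow> real" where
  "T_P x y = x * y"

locale nonatomic_prob_space = prob_space +
  assumes nonatomic:
    "E \<in> events \<Longrightarrow> prob E > 0 \<Longrightarrow> \<exists>F\<in>events. F \<subseteq> E \<and> 0 < prob F \<and> prob F < prob E"

text \<open>Operations and chains are indexed by all reals, but constrained only on the unit
  interval; their values outside it are irrelevant.\<close>

definition event_chain :: "'a measure \<Rightarrow> (real \<Rightarrow> 'a set) \<Rightarrow> bool" where
  "event_chain M A \<longleftrightarrow>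
     mono_on {0..1} A \<and> (\<forall>x\<in>{0..1}. A x \<in> sets M \<and> measure M (A x) = x)"

definition simultaneous_realization ::
  "(real \<Rightarrow> real \<Rightarrow> real) \<Rightarrow> 'a measure \<Rightarrow> (real \<Rightarrow> 'a set) \<Rightarrow> (real \<Rightarrow> 'a set) \<Rightarrow> bool" where
  "simultaneous_realization T M A B \<longleftrightarrow>
     nonatomic_prob_space M \<and> event_chain M A \<and> event_chain M B \<and>
     (\<forall>x\<in>{0..1}. \<forall>y\<in>{0..1}. measure M (A x \<inter> B y) = T x y)"

definition comonotone_chains :: "(real \<Rightarrow> 'a set) \<Rightarrow> (real \<Rightarrow> 'a set) \<Rightarrow> bool" where
  "comonotone_chains A B \<longleftrightarrow>
     (\<forall>x\<in>{0..1}. \<forall>y\<in>{0..1}. A x \<subseteq> B y \<or> B y \<subseteq> A x)"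

definition countermonotone_chains ::
  "'a measure \<Rightarrow> (real \<Rightarrow> 'a set) \<Rightarrow> (real \<Rightarrow> 'a set) \<Rightarrow> bool" where
  "countermonotone_chains M A B \<longleftrightarrow>
     (\<forall>x\<in>{0..1}. \<forall>y\<in>{0..1}. A x \<subseteq> space M - B y \<or> space M - B y \<subseteq> A x)"

definition independent_chains ::
  "'a measure \<Rightarrow> (real \<Rightarrow> 'a set) \<Rightarrow> (real \<Rightarrow> 'a set) \<Rightarrow> bool" where
  "independent_chains M A B \<longleftrightarrow>
     (\<forall>x\<in>{0..1}. \<forall>y\<in>{0..1}. measure M (A x \<inter> B y) = measure M (A x) * measure M (B y))"

end

theory Submission
  imports Defs
begin

text \<open>All three realizations live on the unit square with uniform measure. The first chain is
  always the chain of left strips \<open>{..x} \<times> UNIV\<close>; it is paired with itself, with the chain of right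
  strips \<open>{1 - y..} \<times> UNIV\<close>, and with the chain of lower strips \<open>UNIV \<times> {..y}\<close>.\<close>

text \<open>The slices \<open>A ((k + 1) / n) - A (k / n)\<close> have probability \<open>1 / n\<close> and cover almost everything,
  so for large \<open>n\<close> one of them cuts a proper part of positive probability out of \<open>E\<close>.\<close>

lemma (in prob_space) nonatomic_if_event_chain:
  assumes chain: "event_chain M A"
  shows "nonatomic_prob_space M"
proof
  fix E assume E: "E \<in> events" and pos: "prob E > 0"
  \<comment> \<open>With this \<open>n\<close>, a slice of mass \<open>1 / n\<close> is too small to
    contain almost all of \<open>E\<close>, so whatever it cuts out of \<open>E\<close> has smaller
    probability.\<close>
  obtain n :: nat where n: "n > 0" "1 / real n < prob E"
    using reals_Archimedean[OF pos] by (metis inverse_eq_divide zero_less_Suc)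
  have A: "A x \<in> events" "prob (A x) = x" if "x \<in> {0..1}" for x
    using chain that by (auto simp: event_chain_def)
  define g where "g k = prob (E \<inter> A (real k / real n))" for k
  have g0: "g 0 = 0"
  proof -
    have "prob (E \<inter> A 0) \<le> prob (A 0)"
      using A(1)[of 0] by (intro finite_measure_mono) auto
    then show ?thesis
      using A(2)[of 0] by (simp add: g_def measure_le_0_iff)
  qed
  have gn: "g n = prob E"
  proof -
    \<comment> \<open>\<open>A 1\<close> has probability 1 but may miss a null set, so
      \<open>E\<close> and \<open>E \<inter> A 1\<close> agree only almost everywhere.\<close>
    have "AE \<omega> in M. \<omega> \<in> A 1"
      using A(1)[of 1] A(2)[of 1] by (simp add: prob_eq_1)
    then have "prob (E \<inter> A 1) = prob E"
      using E A(1)[of 1] by (intro finite_measure_eq_AE) auto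
    then show ?thesis
      using n by (simp add: g_def)
  qed
  \<comment> \<open>Otherwise \<open>g\<close> would never rise on its way from
    \<open>g 0 = 0\<close> to \<open>g n = prob E > 0\<close>.\<close>
  have "\<exists>k<n. g k < g (Suc k)"
  proof (rule ccontr)
    assume *: "\<not> ?thesis"
    have "g k \<le> 0" if "k \<le> n" for k
      using that
    proof (induction k)
      case (Suc k)
      then have "g (Suc k) \<le> g k"
        using * by (meson Suc_le_lessD not_le)
      with Suc show ?case by simp
    qed (simp add: g0)
    then show False
      using gn pos by fastforce
  qed
  then obtain k where k: "k < n" "g k < g (Suc k)" by blast
  define a b where "a = real k / real n" and "b = real (Suc k) / real n"
  have ab: "a \<in> {0..1}" "b \<in> {0..1}" "a \<le> b" "b - a = 1 / real n"
    using k n by (auto simp: a_def b_def field_simps)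
  have sub: "A a \<subseteq> A b"
    using chain ab by (auto simp: event_chain_def mono_on_def)
  let ?F = "E \<inter> (A b - A a)"
  have "prob ?F = prob (E \<inter> A b - E \<inter> A a)"
    by (rule arg_cong[where f = prob]) auto
  also have "\<dots> = g (Suc k) - g k"
    using E A ab sub by (subst finite_measure_Diff) (auto simp: g_def a_def b_def)
  finally have "0 < prob ?F"
    using k by simp
  moreover have "prob ?F \<le> prob (A b - A a)"
    using A ab by (intro finite_measure_mono) auto
  then have "prob ?F < prob E"
    using A ab sub n by (simp add: finite_measure_Diff)
  moreover have "?F \<in> events"
    using E A ab by auto
  ultimately show "\<exists>F\<in>events. F \<subseteq> E \<and> 0 < prob F \<and> prob F < prob E"
    by blast
qed

text \<open>Nonatomicity comes for free from the chain \<open>A\<close>, which leaves only the chain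
  conditions and the joint probabilities to check.\<close>

lemma (in prob_space) simultaneous_realizationI:
  assumes "event_chain M A" "event_chain M B"
    and "\<And>x y. x \<in> {0..1} \<Longrightarrow> y \<in> {0..1} \<Longrightarrow> prob (A x \<inter> B y) = T x y"
  shows "simultaneous_realization T M A B"
  using assms nonatomic_if_event_chain by (simp add: simultaneous_realization_def)

text \<open>The carrier is the whole line with all mass on the unit interval, so rays and
  \<open>UNIV\<close> serve as events without being cut down to the interval.\<close>

definition unit_uniform :: "real measure" where
  "unit_uniform = uniform_measure lborel {0..1}"

lemma sets_unit_uniform [simp, measurable_cong]: "sets unit_uniform = sets borel"
  by (simp add: unit_uniform_def)

lemma space_unit_uniform [simp]: "space unit_uniform = UNIV"
  by (simp add: unit_uniform_def)

interpretation unit_uniform: prob_space unit_uniform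
  unfolding unit_uniform_def by (rule prob_space_uniform_measure) auto

lemma measure_unit_uniform:
  "X \<in> sets borel \<Longrightarrow> measure unit_uniform X = measure lborel ({0..1} \<inter> X)"
  unfolding unit_uniform_def by (subst measure_uniform_measure) auto

definition square_uniform :: "(real \<times> real) measure" where
  "square_uniform = unit_uniform \<Otimes>\<^sub>M unit_uniform"

interpretation square_uniform: prob_space square_uniform
  unfolding square_uniform_def
  by (intro prob_space_pair unit_uniform.prob_space_axioms)

lemma space_square_uniform: "space square_uniform = UNIV"
  by (simp add: square_uniform_def space_pair_measure)

lemma sets_square_uniform_Times:
  "X \<in> sets borel \<Longrightarrow> Y \<in> sets borel \<Longrightarrow> X \<times> Y \<in> sets square_uniform"
  by (simp add: square_uniform_def)

lemma measure_square_uniform_Times: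
  assumes "X \<in> sets borel" "Y \<in> sets borel"
  shows "measure square_uniform (X \<times> Y) =
    measure lborel ({0..1} \<inter> X) * measure lborel ({0..1} \<inter> Y)"
  using assms
  by (simp add: square_uniform_def measure_def unit_uniform.emeasure_pair_measure_Times enn2real_mult
      flip: measure_unit_uniform[unfolded measure_def])

lemma measure_unit_atMost: "x \<in> {0..1} \<Longrightarrow> measure lborel ({0..1} \<inter> {..x}) = (x::real)"
  by (simp add: Int_atMost)

lemma measure_unit_atLeast: "x \<in> {0..1} \<Longrightarrow> measure lborel ({0..1} \<inter> {x..}) = 1 - (x::real)"
proof -
  assume "x \<in> {0..1}"
  then have "{0..1} \<inter> {x..} = {x..1}"
    by auto
  then show ?thesis
    using \<open>x \<in> {0..1}\<close> by simp
qed

lemmas measure_square_simps =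
  measure_square_uniform_Times measure_unit_atMost measure_unit_atLeast

lemma event_chain_left: "event_chain square_uniform (\<lambda>x. {..x} \<times> UNIV)"
  by (auto simp: event_chain_def mono_on_def sets_square_uniform_Times measure_square_simps)

lemma event_chain_right: "event_chain square_uniform (\<lambda>y. {1 - y..} \<times> UNIV)"
  by (auto simp: event_chain_def mono_on_def sets_square_uniform_Times measure_square_simps)

lemma event_chain_lower: "event_chain square_uniform (\<lambda>y. UNIV \<times> {..y})"
  by (auto simp: event_chain_def mono_on_def sets_square_uniform_Times measure_square_simps)

lemma measure_left_Int_left:
  assumes "x \<in> {0..1}" "y \<in> {0..1}"
  shows "measure square_uniform (({..x} \<times> UNIV) \<inter> ({..y} \<times> UNIV)) = T_G x y"
proof -
  have "({..x} \<times> UNIV) \<inter> ({..y} \<times> UNIV) = {..min x y} \<times> (UNIV :: real set)"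
    by auto
  then show ?thesis
    using assms by (simp add: measure_square_simps T_G_def min_def)
qed

text \<open>The two strips overlap above \<open>{1 - y..x}\<close>, of length
  \<open>x + y - 1\<close> when \<open>1 - y \<le> x\<close>; otherwise they are disjoint, which is
  the 0 in the maximum.\<close>

lemma measure_left_Int_right:
  assumes "x \<in> {0..1}" "y \<in> {0..1}"
  shows "measure square_uniform (({..x} \<times> UNIV) \<inter> ({1 - y..} \<times> UNIV)) = T_L x y"
proof -
  have "({..x} \<times> UNIV) \<inter> ({1 - y..} \<times> UNIV) = {1 - y..x} \<times> (UNIV :: real set)"
    by auto
  moreover have "{0..1} \<inter> {1 - y..x} = {1 - y..x}"
    using assms by auto
  \<comment> \<open>\<open>Int_atLeastAtMost\<close> would rewrite the intersection with the unit
    interval into max/min bounds before the preceding equation could apply.\<close>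
  ultimately show ?thesis
    by (simp add: measure_square_uniform_Times T_L_def del: Int_atLeastAtMost)
qed

lemma measure_left_Int_lower:
  assumes "x \<in> {0..1}" "y \<in> {0..1}"
  shows "measure square_uniform (({..x} \<times> UNIV) \<inter> (UNIV \<times> {..y})) = T_P x y"
proof -
  have "({..x} \<times> UNIV) \<inter> (UNIV \<times> {..y}) = {..x} \<times> {..y}"
    by auto
  then show ?thesis
    using assms by (simp add: measure_square_simps T_P_def)
qed

theorem proposition12:
  shows "(\<exists>(M :: (real \<times> real) measure) A B.
            simultaneous_realization T_G M A B \<and> comonotone_chains A B) \<and>
         (\<exists>(M :: (real \<times> real) measure) A B.
            simultaneous_realization T_L M A B \<and> countermonotone_chains M A B) \<and>
         (\<exists>(M :: (real \<times> real) measure) A B.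
            simultaneous_realization T_P M A B \<and> independent_chains M A B)"
proof (intro conjI exI)
  show "simultaneous_realization T_G square_uniform (\<lambda>x. {..x} \<times> UNIV) (\<lambda>y. {..y} \<times> UNIV)"
    by (intro square_uniform.simultaneous_realizationI event_chain_left measure_left_Int_left)
  show "comonotone_chains (\<lambda>x::real. {..x} \<times> (UNIV::real set)) (\<lambda>y. {..y} \<times> UNIV)"
    by (auto simp: comonotone_chains_def)
  show "simultaneous_realization T_L square_uniform (\<lambda>x. {..x} \<times> UNIV) (\<lambda>y. {1 - y..} \<times> UNIV)"
    by (intro square_uniform.simultaneous_realizationI event_chain_left event_chain_right
        measure_left_Int_right)
  \<comment> \<open>The complement of a right strip is \<open>{..<1 - y} \<times> UNIV\<close>,
    again a left strip, now open; strips over down-sets of the line are always comparable.\<close>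
  show "countermonotone_chains square_uniform (\<lambda>x. {..x} \<times> UNIV) (\<lambda>y. {1 - y..} \<times> UNIV)"
    by (auto simp: countermonotone_chains_def space_square_uniform)
  show P: "simultaneous_realization T_P square_uniform (\<lambda>x. {..x} \<times> UNIV) (\<lambda>y. UNIV \<times> {..y})"
    by (intro square_uniform.simultaneous_realizationI event_chain_left event_chain_lower
        measure_left_Int_lower)
  \<comment> \<open>The chain conditions give the marginals x and y, so the realized value
    \<open>x * y\<close> is already their product.\<close>
  then show "independent_chains square_uniform (\<lambda>x. {..x} \<times> UNIV) (\<lambda>y. UNIV \<times> {..y})"
    by (auto simp: independent_chains_def simultaneous_realization_def event_chain_def T_P_def)
qed

end
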